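(* Let $X$ be a strongly regular graph. Then for any pair of distinct vertices $u,v$ of $X$, there is a choice of real numbers $\beta,\gamma$ such that there is pretty good state transfer between $u$ and $v$ in $X^{\beta,\gamma}_{u,v}$.
   Context: A strongly regular graph with parameters $(n,k,a,c)$ is a graph on $n$ vertices, neither empty nor complete, in which every vertex has degree $k$, every two adjacent vertices have $a$ common neighbours, and every two distinct non-adjacent vertices have $c$ common neighbours. Throughout, strongly regular graphs are taken to have exactly three distinct adjacency eigenvalues $k,\theta,\tau$, with $k$ simple (equivalently, the graph is connected). For a graph $X$ with adjacency matrix $A$, distinct vertices $u,v$ and real $\beta,\gamma$, let $X^{\beta,\gamma}=X^{\beta,\gamma}_{u,v}$ be the weighted graph with adjacency matrix $A+H$, where $H=\beta(e_ue_v^T+e_ve_u^T)+\gamma(e_ue_u^T+e_ve_v^T)$ and $e_w$ denotes the standard basis vector indexed by $w$. For a (weighted) graph with real symmetric adjacency matrix $M$, let $U(t)=\exp(itM)$. There is pretty good state transfer from $u$ to $v$ if for every $\epsilon>0$ there is $t>0$ with $|U(t)_{u,v}|>1-\epsilon$. *)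

theory Defs
  imports "HOL-Analysis.Analysis"
begin

(* A graph is given by its adjacency relation on the finite vertex type 'v. *)

definition simple_graph :: "('v \<Rightarrow> 'v \<Rightarrow> bool) \<Rightarrow> bool" where
  "simple_graph E \<longleftrightarrow> symp E \<and> irreflp E"

definition strongly_regular ::
    "('v::finite \<Rightarrow> 'v \<Rightarrow> bool) \<Rightarrow> nat \<Rightarrow> nat \<Rightarrow> nat \<Rightarrow> nat \<Rightarrow> bool" where
  "strongly_regular E n k a c \<longleftrightarrow>
     simple_graph E \<and> CARD('v) = n \<and>
     (\<exists>x y. E x y) \<and> (\<exists>x y. x \<noteq> y \<and> \<not> E x y) \<and>
     (\<forall>x. card {y. E x y} = k) \<and>
     (\<forall>x y. E x y \<longrightarrow> card {z. E x z \<and> E y z} = a) \<and>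
     (\<forall>x y. x \<noteq> y \<longrightarrow> \<not> E x y \<longrightarrow> card {z. E x z \<and> E y z} = c)"

definition adj_matrix :: "('v::finite \<Rightarrow> 'v \<Rightarrow> bool) \<Rightarrow> real^'v^'v" where
  "adj_matrix E = (\<chi> x y. if E x y then 1 else 0)"

definition eigenspace :: "real^'v^'v \<Rightarrow> real \<Rightarrow> (real^'v) set" where
  "eigenspace M l = {x. M *v x = l *\<^sub>R x}"

(* Real eigenvalues only: no restriction for the symmetric matrices considered here. *)
definition eigenvalues :: "real^'v^'v \<Rightarrow> real set" where
  "eigenvalues M = {l. \<exists>x \<in> eigenspace M l. x \<noteq> 0}"

(* For a symmetric matrix the geometric and algebraic multiplicities agree. *)
definition simple_eigenvalue :: "real^'v^'v \<Rightarrow> real \<Rightarrow> bool" where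
  "simple_eigenvalue M l \<longleftrightarrow> dim (eigenspace M l) = 1"

definition outer_prod :: "real^'v \<Rightarrow> real^'v \<Rightarrow> real^'v^'v" where
  "outer_prod x y = (\<chi> i j. x $ i * y $ j)"

definition perturbation :: "'v::finite \<Rightarrow> 'v \<Rightarrow> real \<Rightarrow> real \<Rightarrow> real^'v^'v" where
  "perturbation u v \<beta> \<gamma> =
     \<beta> *\<^sub>R (outer_prod (axis u 1) (axis v 1) + outer_prod (axis v 1) (axis u 1)) +
     \<gamma> *\<^sub>R (outer_prod (axis u 1) (axis u 1) + outer_prod (axis v 1) (axis v 1))"

primrec matrix_power :: "complex^'v^'v \<Rightarrow> nat \<Rightarrow> complex^'v^'v" where
  "matrix_power M 0 = mat 1"
| "matrix_power M (Suc m) = M ** matrix_power M m"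

(* The library's exp does not apply: the ring structure on the type of square
   matrices is componentwise.  The series converges for every M. *)
definition matrix_exp :: "complex^'v^'v \<Rightarrow> complex^'v^'v" where
  "matrix_exp M = (\<Sum>m. matrix_power M m /\<^sub>R fact m)"

definition transition_matrix :: "real^'v^'v \<Rightarrow> real \<Rightarrow> complex^'v^'v" where
  "transition_matrix M t = matrix_exp (map_matrix (\<lambda>x. \<i> * of_real t * of_real x) M)"

definition pretty_good_state_transfer :: "real^'v^'v \<Rightarrow> 'v \<Rightarrow> 'v \<Rightarrow> bool" where
  "pretty_good_state_transfer M u v \<longleftrightarrow>
     (\<forall>\<epsilon>>0. \<exists>t>0. cmod (transition_matrix M t $ u $ v) > 1 - \<epsilon>)"

end

theory Submission
  imports Defs
begin

text \<open>
  Write \<open>s = e\<^sub>u + e\<^sub>v\<close>, \<open>d = e\<^sub>u - e\<^sub>v\<close> and take \<open>\<beta> = - q/2\<close>, \<open>\<gamma> = q/2\<close>, so that the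
  perturbation is the rank-one matrix \<open>(q/2) d d\<^sup>T\<close>.  Transfer from \<open>u\<close> to \<open>v\<close> happens at time \<open>t\<close>
  up to a phase \<open>\<omega>\<close> as soon as \<open>s\<close> is almost multiplied by \<open>\<omega>\<close> and \<open>d\<close> almost by \<open>-\<omega>\<close>.
  Hence it suffices to expand \<open>s\<close> and \<open>d\<close> into eigenvectors and to find times at which the
  eigenvalues occurring in \<open>s\<close> have phase near \<open>\<omega>\<close> and those occurring in \<open>d\<close> have phase near
  \<open>-\<omega>\<close> (\<open>pretty_good_state_transfer_criterion\<close>).

  In a strongly regular graph \<open>A\<^sup>2 = (k - c) I + (a - c) A + c J\<close>, so on the orthogonal complement of
  the all-ones vector \<open>A\<close> satisfies a quadratic equation, whose roots are \<open>\<theta>\<close> and \<open>\<tau>\<close>.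
  All vectors \<open>A\<^sup>m s\<close> take equal values at \<open>u\<close> and \<open>v\<close>, so they are orthogonal to \<open>d\<close> and the
  perturbation does not see them: whatever \<open>q\<close> is, only the old eigenvalues \<open>k, \<theta>, \<tau>\<close> occur in \<open>s\<close>
  (\<open>symmetric_vector_in_span\<close>).  The span of \<open>d\<close> and \<open>A d\<close> is invariant as well, and there the
  perturbation does move the eigenvalues.  With \<open>r\<close> and \<open>w \<ge> 0\<close> depending only on the graph and
  the pair, the two new eigenvalues are \<open>r + y\<close> and \<open>r - w/y\<close>, where \<open>y > 0\<close> can be prescribed
  freely through \<open>q\<close> (\<open>antisymmetric_vector_in_span\<close>).  If \<open>w = 0\<close>, then \<open>d\<close> is itself an
  eigenvector and only \<open>r + y\<close> occurs in it.

  It remains to choose \<open>y\<close>.  For \<open>w > 0\<close> an integer relation between \<open>\<theta> - k\<close>, \<open>\<tau> - k\<close>, \<open>r - k + y\<close> and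
  \<open>r - k - w/y\<close> that involves one of the last two is a nonzero polynomial equation of degree at
  most two in \<open>y\<close>.  There are countably many such equations, so all but countably many \<open>y\<close> satisfy
  none of them, and Kronecker's approximation theorem then provides the times
  (\<open>exists_parameter_aligning_phases\<close>).  In the case \<open>w = 0\<close> the same choice of \<open>y\<close>, made with
  \<open>1\<close> in place of \<open>w\<close>, takes care of the single eigenvalue \<open>r + y\<close>.
\<close>

section \<open>Evolution of eigenvectors\<close>

lemma norm_matrix_power_entry_le:
  fixes M :: "complex^'v^'v"
  assumes "\<And>i j. cmod (M $ i $ j) \<le> B"
  shows "cmod (matrix_power M m $ i $ j) \<le> (real CARD('v) * B) ^ m"
proof (induction m arbitrary: i j)
  case 0
  then show ?case by (simp add: mat_def)
next
  case (Suc m)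
  have B: "0 \<le> B" using assms norm_ge_zero order_trans by blast
  have "cmod (matrix_power M (Suc m) $ i $ j) \<le>
      (\<Sum>l\<in>UNIV. cmod (M $ i $ l) * cmod (matrix_power M m $ l $ j))"
    by (simp add: matrix_matrix_mult_def norm_mult sum_norm_le)
  also have "\<dots> \<le> (\<Sum>l\<in>(UNIV::'v set). B * (real CARD('v) * B) ^ m)"
    using B by (intro sum_mono mult_mono assms Suc.IH) auto
  finally show ?case by (simp add: mult_ac)
qed

text \<open>
  The entries of the \<open>m\<close>-th power grow at most geometrically, so the exponential series dominates.
\<close>

lemma summable_matrix_exp:
  fixes M :: "complex^'v^'v"
  shows "summable (\<lambda>m. matrix_power M m /\<^sub>R fact m)"
proof -
  define B where "B = (\<Sum>i\<in>UNIV. \<Sum>j\<in>UNIV. cmod (M $ i $ j))"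
  have B: "cmod (M $ i $ j) \<le> B" for i j
  proof -
    have "cmod (M $ i $ j) \<le> (\<Sum>j\<in>UNIV. cmod (M $ i $ j))"
      by (rule member_le_sum) auto
    also have "\<dots> \<le> B"
      unfolding B_def by (rule member_le_sum[of i UNIV "\<lambda>i. \<Sum>j\<in>UNIV. cmod (M $ i $ j)"])
        (auto simp: sum_nonneg)
    finally show ?thesis .
  qed
  define C where "C = real CARD('v) * B"
  have bound: "norm (matrix_power M m) \<le> (\<Sum>i\<in>(UNIV::'v set). \<Sum>j\<in>(UNIV::'v set). C ^ m)" for m
  proof -
    have "norm (matrix_power M m) \<le> (\<Sum>i\<in>UNIV. norm (matrix_power M m $ i))"
      unfolding norm_vec_def[of "matrix_power M m"] by (rule L2_set_le_sum) simp
    also have "\<dots> \<le> (\<Sum>i\<in>UNIV. \<Sum>j\<in>UNIV. cmod (matrix_power M m $ i $ j))"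
      by (intro sum_mono, subst norm_vec_def, rule L2_set_le_sum) simp
    also have "\<dots> \<le> (\<Sum>i\<in>(UNIV::'v set). \<Sum>j\<in>(UNIV::'v set). C ^ m)"
      unfolding C_def by (intro sum_mono norm_matrix_power_entry_le B)
    finally show ?thesis .
  qed
  have "summable (\<lambda>m. (\<Sum>i\<in>(UNIV::'v set). \<Sum>j\<in>(UNIV::'v set). C ^ m /\<^sub>R fact m))"
    by (intro summable_sum summable_exp_generic)
  then show ?thesis
  proof (rule summable_comparison_test'[where N = 0])
    fix m
    show "norm (matrix_power M m /\<^sub>R fact m) \<le>
        (\<Sum>i\<in>(UNIV::'v set). \<Sum>j\<in>(UNIV::'v set). C ^ m /\<^sub>R fact m)"
      using mult_left_mono[OF bound[of m], of "inverse (fact m)"]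
      by (simp add: sum_distrib_left mult_ac)
  qed
qed

lemma matrix_exp_eigenvector:
  fixes M :: "complex^'v^'v"
  assumes "M *v z = l *s z"
  shows "matrix_exp M *v z = exp l *s z"
proof -
  have pow: "matrix_power M m *v z = l ^ m *s z" for m
    by (induction m)
      (simp_all add: assms vector_scalar_commute mult.commute flip: matrix_vector_mul_assoc)
  have lin: "bounded_linear (\<lambda>N :: complex^'v^'v. N *v z)"
    by (rule linear_conv_bounded_linear[THEN iffD1], rule linearI)
      (simp_all add: matrix_vector_mult_add_rdistrib vec_eq_iff matrix_vector_mult_def
        scaleR_sum_right distrib_right sum.distrib)
  have lin': "bounded_linear (\<lambda>c :: complex. c *s z)"
    by (rule linear_conv_bounded_linear[THEN iffD1], rule linearI)
      (simp_all add: vec_eq_iff algebra_simps)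
  have "matrix_exp M *v z = (\<Sum>m. (matrix_power M m /\<^sub>R fact m) *v z)"
    unfolding matrix_exp_def by (rule bounded_linear.suminf[OF lin summable_matrix_exp])
  also have "\<dots> = (\<Sum>m. (l ^ m /\<^sub>R fact m) *s z)"
    by (simp add: linear_scale[OF bounded_linear.linear[OF lin]]
        linear_scale[OF bounded_linear.linear[OF lin']] pow)
  also have "\<dots> = exp l *s z"
    unfolding exp_def by (rule bounded_linear.suminf[OF lin' summable_exp_generic, symmetric])
  finally show ?thesis .
qed

definition complex_vec :: "real^'v \<Rightarrow> complex^'v" where
  "complex_vec x = (\<chi> i. of_real (x $ i))"

lemma linear_complex_vec: "linear complex_vec"
  by (rule linearI) (simp_all add: complex_vec_def vec_eq_iff scaleR_conv_of_real[where 'a=complex])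

lemma transition_matrix_eigenvector:
  fixes M :: "real^'v^'v"
  assumes "x \<in> eigenspace M l"
  shows "transition_matrix M t *v complex_vec x = cis (t * l) *s complex_vec x"
proof -
  have Mx: "(\<Sum>j\<in>UNIV. M $ i $ j * x $ j) = l * x $ i" for i
    using assms by (simp add: eigenspace_def vec_eq_iff matrix_vector_mult_def)
  have "map_matrix (\<lambda>x. \<i> * of_real t * of_real x) M *v complex_vec x
      = (\<i> * of_real (t * l)) *s complex_vec x"
  proof (simp add: vec_eq_iff, intro allI)
    fix i
    have "(map_matrix (\<lambda>x. \<i> * of_real t * of_real x) M *v complex_vec x) $ i
      = \<i> * of_real t * of_real (\<Sum>j\<in>UNIV. M $ i $ j * x $ j)"
      by (simp add: matrix_vector_mult_def map_matrix_def complex_vec_def sum_distrib_left mult_ac)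
    then show "(map_matrix (\<lambda>x. \<i> * of_real t * of_real x) M *v complex_vec x) $ i =
       \<i> * (complex_of_real t * complex_of_real l) * complex_vec x $ i"
      by (simp add: Mx complex_vec_def)
  qed
  from matrix_exp_eigenvector[OF this] show ?thesis
    by (simp add: transition_matrix_def cis_conv_exp)
qed

text \<open>
  The evolution multiplies each eigenvector by the phase of its eigenvalue.  If all phases from \<open>S\<close>
  are near one number \<open>\<omega>\<close>, a combination of eigenvectors is therefore nearly multiplied by \<open>\<omega>\<close>;
  that \<open>C\<close> depends on the combination but not on the time or the accuracy is what makes the
  estimate usable for a limit along varying times.
\<close>

lemma transition_matrix_span_eigenspaces:
  fixes M :: "real^'v^'v"
  assumes "x \<in> span (\<Union>l\<in>S. eigenspace M l)"
  obtains C where "0 \<le> C"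
    "\<And>t \<omega> \<epsilon>. \<lbrakk>\<And>l. l \<in> S \<Longrightarrow> cmod (cis (t * l) - \<omega>) \<le> \<epsilon>; 0 \<le> \<epsilon>\<rbrakk> \<Longrightarrow>
       norm (transition_matrix M t *v complex_vec x - \<omega> *s complex_vec x) \<le> C * \<epsilon>"
proof -
  define err where "err t \<omega> x =
    transition_matrix M t *v complex_vec x - \<omega> *s complex_vec x" for t \<omega> x
  have lin: "linear (err t \<omega>)" for t \<omega>
  proof -
    have "linear (\<lambda>z::complex^'v. transition_matrix M t *v z)" by simp
    moreover have "linear (\<lambda>z::complex^'v. \<omega> *s z)"
      by (rule linearI) (simp_all add: vec_eq_iff algebra_simps)
    ultimately show ?thesis
      unfolding err_def
      by (intro linear_compose_sub linear_compose[OF linear_complex_vec, unfolded o_def])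
  qed
  have "\<exists>C\<ge>0. \<forall>t \<omega> \<epsilon>. (\<forall>l\<in>S. cmod (cis (t * l) - \<omega>) \<le> \<epsilon>) \<longrightarrow> 0 \<le> \<epsilon> \<longrightarrow>
      norm (err t \<omega> x) \<le> C * \<epsilon>" (is "?P x")
    using assms
  proof (induction rule: span_induct_alt)
    case base
    then show ?case by (auto simp: linear_0[OF lin])
  next
    case (step r x y)
    then obtain l C where l: "l \<in> S" "x \<in> eigenspace M l" and "0 \<le> C" and
      C: "\<And>t \<omega> \<epsilon>. (\<forall>l\<in>S. cmod (cis (t * l) - \<omega>) \<le> \<epsilon>) \<Longrightarrow> 0 \<le> \<epsilon> \<Longrightarrow>
        norm (err t \<omega> y) \<le> C * \<epsilon>" by blast
    have "norm (err t \<omega> (r *\<^sub>R x + y)) \<le> (\<bar>r\<bar> * norm (complex_vec x) + C) * \<epsilon>"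
      if near: "\<forall>l\<in>S. cmod (cis (t * l) - \<omega>) \<le> \<epsilon>" and "0 \<le> \<epsilon>" for t \<omega> \<epsilon>
    proof -
      have "err t \<omega> x = (cis (t * l) - \<omega>) *s complex_vec x"
        by (simp add: err_def transition_matrix_eigenvector[OF l(2)] vec_eq_iff algebra_simps)
      moreover have "norm (c *s z) = cmod c * norm z" for c :: complex and z :: "complex^'v"
        by (simp add: norm_vec_def norm_mult L2_set_left_distrib L2_set_right_distrib)
      ultimately have "norm (err t \<omega> x) = cmod (cis (t * l) - \<omega>) * norm (complex_vec x)"
        by metis
      then have "norm (err t \<omega> x) \<le> \<epsilon> * norm (complex_vec x)"
        using near l(1) by (auto intro: mult_right_mono)
      then have "\<bar>r\<bar> * norm (err t \<omega> x) \<le> \<bar>r\<bar> * (\<epsilon> * norm (complex_vec x))"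
        by (rule mult_left_mono) simp
      moreover have "norm (err t \<omega> (r *\<^sub>R x + y)) \<le> \<bar>r\<bar> * norm (err t \<omega> x) + norm (err t \<omega> y)"
        using norm_triangle_ineq[of "r *\<^sub>R err t \<omega> x" "err t \<omega> y"]
        by (simp add: linear_add[OF lin] linear_scale[OF lin])
      ultimately show ?thesis
        using C[OF near \<open>0 \<le> \<epsilon>\<close>] by (simp add: algebra_simps)
    qed
    with \<open>0 \<le> C\<close> show ?case
      by (intro exI[of _ "\<bar>r\<bar> * norm (complex_vec x) + C"]) auto
  qed
  then show ?thesis using that unfolding err_def by blast
qed

text \<open>
  Since \<open>2 e\<^sub>v = (e\<^sub>u + e\<^sub>v) - (e\<^sub>u - e\<^sub>v)\<close>, an evolution acting almost as \<open>\<omega>\<close> on the sum and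
  almost as \<open>-\<omega>\<close> on the difference sends \<open>e\<^sub>v\<close> close to \<open>\<omega> e\<^sub>u\<close>.
\<close>

lemma pretty_good_state_transfer_criterion:
  fixes M :: "real^'v^'v"
  assumes plus: "axis u 1 + axis v 1 \<in> span (\<Union>l\<in>S. eigenspace M l)"
    and minus: "axis u 1 - axis v 1 \<in> span (\<Union>l\<in>T. eigenspace M l)"
    and phases: "\<And>\<epsilon>. 0 < \<epsilon> \<Longrightarrow> \<exists>t>0. \<exists>\<omega>. cmod \<omega> = 1 \<and>
        (\<forall>l\<in>S. cmod (cis (t * l) - \<omega>) \<le> \<epsilon>) \<and> (\<forall>l\<in>T. cmod (cis (t * l) + \<omega>) \<le> \<epsilon>)"
  shows "pretty_good_state_transfer M u v"
  unfolding pretty_good_state_transfer_def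
proof (intro allI impI)
  fix \<epsilon> :: real assume "0 < \<epsilon>"
  let ?s = "axis u 1 + axis v 1 :: real^'v" and ?d = "axis u 1 - axis v 1 :: real^'v"
  obtain C where C: "0 \<le> C" "\<And>t \<omega> \<epsilon>. \<lbrakk>\<And>l. l \<in> S \<Longrightarrow> cmod (cis (t * l) - \<omega>) \<le> \<epsilon>; 0 \<le> \<epsilon>\<rbrakk> \<Longrightarrow>
       norm (transition_matrix M t *v complex_vec ?s - \<omega> *s complex_vec ?s) \<le> C * \<epsilon>"
    using transition_matrix_span_eigenspaces[OF plus] by blast
  obtain D where D: "0 \<le> D" "\<And>t \<omega> \<epsilon>. \<lbrakk>\<And>l. l \<in> T \<Longrightarrow> cmod (cis (t * l) - \<omega>) \<le> \<epsilon>; 0 \<le> \<epsilon>\<rbrakk> \<Longrightarrow>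
       norm (transition_matrix M t *v complex_vec ?d - \<omega> *s complex_vec ?d) \<le> D * \<epsilon>"
    using transition_matrix_span_eigenspaces[OF minus] by blast
  define \<eta> where "\<eta> = \<epsilon> / (C + D + 1)"
  have \<eta>: "0 < \<eta>" "(C + D) * \<eta> < \<epsilon>"
    using \<open>0 < \<epsilon>\<close> C(1) D(1) by (auto simp: \<eta>_def field_simps)
  obtain t \<omega> where "t > 0" "cmod \<omega> = 1"
    and near: "\<And>l. l \<in> S \<Longrightarrow> cmod (cis (t * l) - \<omega>) \<le> \<eta>"
      "\<And>l. l \<in> T \<Longrightarrow> cmod (cis (t * l) - (- \<omega>)) \<le> \<eta>"
    using phases[OF \<eta>(1)] by auto
  let ?U = "transition_matrix M t"
  let ?es = "?U *v complex_vec ?s - \<omega> *s complex_vec ?s"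
  let ?ed = "?U *v complex_vec ?d - (- \<omega>) *s complex_vec ?d"
  have lin: "linear (\<lambda>x. ?U *v complex_vec x)"
    by (rule linear_compose[OF linear_complex_vec, unfolded o_def]) simp
  have s_d: "?s - ?d = 2 *\<^sub>R axis v 1" "?s + ?d = 2 *\<^sub>R axis u 1"
    by (simp_all add: scaleR_2)
  have "?U *v complex_vec (?s - ?d) = (?es - ?ed) + \<omega> *s complex_vec (?s + ?d)"
    unfolding linear_diff[OF lin] linear_add[OF linear_complex_vec]
    by (simp add: vec_eq_iff algebra_simps)
  then have "2 *\<^sub>R (?U *v complex_vec (axis v 1)) = (?es - ?ed) + \<omega> *s (2 *\<^sub>R complex_vec (axis u 1))"
    unfolding s_d linear_scale[OF linear_complex_vec] linear_scale[OF matrix_vector_mul_linear] .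
  then have "(2 *\<^sub>R (?U *v complex_vec (axis v 1))) $ u
      = ((?es - ?ed) + \<omega> *s (2 *\<^sub>R complex_vec (axis u 1))) $ u"
    by (rule arg_cong)
  then have "2 *\<^sub>R ((?U *v complex_vec (axis v 1)) $ u)
      = (?es - ?ed) $ u + \<omega> * (2 *\<^sub>R (complex_vec (axis u 1) $ u))"
    by (simp only: vector_add_component vector_scaleR_component vector_smult_component)
  moreover have "(?U *v complex_vec (axis v 1)) $ u = ?U $ u $ v"
    by (simp add: matrix_vector_mult_def complex_vec_def axis_def if_distrib cong: if_cong)
  moreover have "complex_vec (axis u 1) $ u = 1"
    by (simp add: complex_vec_def)
  ultimately have "2 * (?U $ u $ v - \<omega>) = (?es - ?ed) $ u"
    by (simp only: scaleR_conv_of_real) (simp add: algebra_simps)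
  moreover have "cmod ((?es - ?ed) $ u) \<le> norm ?es + norm ?ed"
    by (rule order_trans[OF Finite_Cartesian_Product.norm_nth_le norm_triangle_ineq4])
  moreover have "norm ?es \<le> C * \<eta>" "norm ?ed \<le> D * \<eta>"
    using C(2)[OF near(1)] D(2)[OF near(2)] \<eta>(1) by auto
  moreover have "cmod (2 * (?U $ u $ v - \<omega>)) = 2 * cmod (?U $ u $ v - \<omega>)"
    by (simp only: norm_mult) simp
  ultimately have "2 * cmod (?U $ u $ v - \<omega>) \<le> (C + D) * \<eta>"
    by (simp add: distrib_right)
  moreover have "cmod \<omega> \<le> cmod (?U $ u $ v) + cmod (?U $ u $ v - \<omega>)"
    by (metis norm_minus_commute norm_triangle_sub)
  ultimately have "1 - \<epsilon> < cmod (?U $ u $ v)"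
    using \<open>cmod \<omega> = 1\<close> \<eta>(2) norm_ge_zero[of "?U $ u $ v - \<omega>"] by linarith
  with \<open>t > 0\<close> show "\<exists>t>0. 1 - \<epsilon> < cmod (transition_matrix M t $ u $ v)" by blast
qed

section \<open>Aligning phases\<close>

text \<open>
  An equality \<open>x i = x j\<close> is itself an integer relation, so independence of the family contains the
  injectivity required by Kronecker's theorem for sets.
\<close>

lemma Kronecker_simultaneous:
  fixes x \<alpha> :: "nat \<Rightarrow> real"
  assumes indep: "\<And>c :: nat \<Rightarrow> int. (\<Sum>i<n. of_int (c i) * x i) = 0 \<Longrightarrow> \<forall>i<n. c i = 0"
    and "0 < \<epsilon>"
  obtains t h where "\<And>i. i < n \<Longrightarrow> \<bar>t * x i - of_int (h i) - \<alpha> i\<bar> < \<epsilon>"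
proof -
  interpret Modules.module "(\<lambda>r. (*) (real_of_int r))"
    by (simp add: Modules.module.intro distrib_left mult.commute)
  have inj: "inj_on x {..<n}"
  proof (rule inj_onI, rule ccontr)
    fix i j assume ij: "i \<in> {..<n}" "j \<in> {..<n}" "x i = x j" "i \<noteq> j"
    let ?c = "\<lambda>l. of_bool (l = i) - of_bool (l = j) :: int"
    have "(\<Sum>l<n. of_int (?c l) * x l) = 0"
      using ij by (simp add: left_diff_distrib sum_subtractf of_bool_def if_distrib[of real_of_int]
        if_distrib[of "\<lambda>y. y * _"] cong: if_cong)
    from indep[OF this] ij show False by auto
  qed
  have "independent (x ` {..<n})"
  proof
    assume "dependent (x ` {..<n})"
    then obtain u i where "(\<Sum>y\<in>x ` {..<n}. real_of_int (u y) * y) = 0" "i < n" "u (x i) \<noteq> 0"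
      by (auto simp: dependent_finite)
    with indep[of "u \<circ> x"] show False by (auto simp: sum.reindex[OF inj])
  qed
  then show ?thesis using Kronecker_thm_1[OF _ inj \<open>0 < \<epsilon>\<close>, of \<alpha>] that by blast
qed

text \<open>
  Integer relations between \<open>x1\<close> and \<open>x2\<close> alone do not obstruct the approximation, because both
  have the target \<open>0\<close>, which satisfies every homogeneous relation.  If there is such a relation,
  both numbers are integer multiples of one number \<open>g\<close>, and it suffices to bring \<open>t g\<close> close enough
  to an integer.
\<close>

lemma simultaneous_half_turn:
  fixes x1 x2 y1 y2 \<epsilon> :: real
  assumes nz: "x1 \<noteq> 0" "x2 \<noteq> 0"
    and indep: "\<And>l1 l2 m1 m2 :: int.
      of_int l1 * x1 + of_int l2 * x2 + of_int m1 * y1 + of_int m2 * y2 = 0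
      \<Longrightarrow> m1 = 0 \<and> m2 = 0"
    and "0 < \<epsilon>"
  obtains t h1 h2 k1 k2 where
    "\<bar>t * x1 - of_int h1\<bar> < \<epsilon>" "\<bar>t * x2 - of_int h2\<bar> < \<epsilon>"
    "\<bar>t * y1 - of_int k1 - 1/2\<bar> < \<epsilon>" "\<bar>t * y2 - of_int k2 - 1/2\<bar> < \<epsilon>"
proof (cases "\<exists>l1 l2 :: int. (l1 \<noteq> 0 \<or> l2 \<noteq> 0) \<and> of_int l1 * x1 + of_int l2 * x2 = 0")
  case True
  then obtain l1 l2 :: int where l: "l1 \<noteq> 0 \<or> l2 \<noteq> 0" "of_int l1 * x1 + of_int l2 * x2 = 0"
    by blast
  with nz have l0: "l1 \<noteq> 0" "l2 \<noteq> 0" by auto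
  define g where "g = x1 / of_int l2"
  have x: "x1 = of_int l2 * g" "x2 = of_int (- l1) * g"
    using l0 l(2) by (auto simp: g_def field_simps)
  define L where "L = 1 + \<bar>real_of_int l1\<bar> + \<bar>real_of_int l2\<bar>"
  have L: "1 \<le> L" "\<bar>real_of_int l1\<bar> \<le> L" "\<bar>real_of_int l2\<bar> \<le> L" by (auto simp: L_def)
  define X where "X = nth [g, y1, y2]"
  have "\<exists>t h. \<forall>i<3. \<bar>t * X i - of_int (h i) - nth [0, 1/2, 1/2] i\<bar> < \<epsilon> / L"
  proof (rule Kronecker_simultaneous[where n = 3 and x = X and \<epsilon> = "\<epsilon> / L"
        and \<alpha> = "nth [0, 1/2, 1/2]"])
    fix c :: "nat \<Rightarrow> int"
    assume "(\<Sum>i<3. of_int (c i) * X i) = 0"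
    then have c: "of_int (c 0) * g + of_int (c 1) * y1 + of_int (c 2) * y2 = 0"
      by (simp add: X_def numeral_3_eq_3 numeral_2_eq_2 lessThan_Suc add_ac)
    have "of_int (c 0) * x1 + of_int 0 * x2 + of_int (l2 * c 1) * y1 + of_int (l2 * c 2) * y2
        = of_int l2 * (of_int (c 0) * g + of_int (c 1) * y1 + of_int (c 2) * y2)"
      by (simp add: x algebra_simps)
    also have "\<dots> = 0" by (simp only: c mult_zero_right)
    finally have "of_int (c 0) * x1 + of_int 0 * x2 + of_int (l2 * c 1) * y1 + of_int (l2 * c 2) * y2 = 0" .
    from indep[OF this] l0 have "c 1 = 0" "c 2 = 0" by auto
    with c nz have "c 0 = 0" by (auto simp: x)
    with \<open>c 1 = 0\<close> \<open>c 2 = 0\<close> show "\<forall>i<3. c i = 0"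
      by (auto simp: numeral_3_eq_3 less_Suc_eq numeral_2_eq_2)
  qed (use L \<open>0 < \<epsilon>\<close> in auto)
  then obtain t h where th: "\<bar>t * X i - of_int (h i) - nth [0, 1/2, 1/2] i\<bar> < \<epsilon> / L" if "i < 3" for i
    by blast
  have g: "\<bar>t * g - of_int (h 0)\<bar> < \<epsilon> / L" using th[of 0] by (simp add: X_def)
  have scale: "\<bar>t * (of_int m * g) - of_int (m * h 0)\<bar> < \<epsilon>" if "\<bar>real_of_int m\<bar> \<le> L" for m
  proof -
    have "\<bar>t * (of_int m * g) - of_int (m * h 0)\<bar> = \<bar>real_of_int m\<bar> * \<bar>t * g - of_int (h 0)\<bar>"
      by (simp add: algebra_simps flip: abs_mult)
    also have "\<dots> \<le> L * \<bar>t * g - of_int (h 0)\<bar>" using that by (intro mult_right_mono) auto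
    also have "\<dots> < \<epsilon>" using g L by (simp add: field_simps)
    finally show ?thesis .
  qed
  have "\<epsilon> / L \<le> \<epsilon>" using L \<open>0 < \<epsilon>\<close> by (simp add: field_simps)
  with th[of 1] th[of 2] have "\<bar>t * y1 - of_int (h 1) - 1/2\<bar> < \<epsilon>" "\<bar>t * y2 - of_int (h 2) - 1/2\<bar> < \<epsilon>"
    by (auto simp: X_def)
  with scale[of l2] scale[of "- l1"] L show ?thesis
    by (intro that[of t "l2 * h 0" "- l1 * h 0" "h 1" "h 2"]) (auto simp: x)
next
  case False
  define X where "X = nth [x1, x2, y1, y2]"
  have "\<exists>t h. \<forall>i<4. \<bar>t * X i - of_int (h i) - nth [0, 0, 1/2, 1/2] i\<bar> < \<epsilon>"
  proof (rule Kronecker_simultaneous[where n = 4 and x = X and \<epsilon> = \<epsilon>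
        and \<alpha> = "nth [0, 0, 1/2, 1/2]"])
    fix c :: "nat \<Rightarrow> int"
    assume "(\<Sum>i<4. of_int (c i) * X i) = 0"
    then have c: "of_int (c 0) * x1 + of_int (c 1) * x2 + of_int (c 2) * y1 + of_int (c 3) * y2 = 0"
      by (simp add: X_def numeral_3_eq_3 numeral_2_eq_2 numeral_eq_Suc[of "num.Bit0 _"] lessThan_Suc add_ac)
    from indep[OF this] have "c 2 = 0" "c 3 = 0" by auto
    with c False have "c 0 = 0" "c 1 = 0" by auto
    with \<open>c 2 = 0\<close> \<open>c 3 = 0\<close> show "\<forall>i<4. c i = 0"
      by (auto simp: eval_nat_numeral less_Suc_eq)
  qed (use \<open>0 < \<epsilon>\<close> in auto)
  then obtain t h where th: "\<bar>t * X i - of_int (h i) - nth [0, 0, 1/2, 1/2] i\<bar> < \<epsilon>" if "i < 4" for i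
    by blast
  from th[of 0] th[of 1] th[of 2] th[of 3] show ?thesis
    by (intro that) (auto simp: X_def)
qed

text \<open>
  Multiplied by \<open>y\<close>, a relation becomes a polynomial equation in \<open>y\<close> with quadratic coefficient \<open>m1\<close>
  and constant coefficient \<open>- m2 w\<close>.  The nonzero ones among these countably many polynomials have
  only countably many roots altogether, and any other \<open>y > 0\<close> will do.
\<close>

lemma exists_generic_parameter:
  fixes x1 x2 r w :: real
  assumes "0 < w"
  obtains y where "0 < y"
    "\<And>l1 l2 m1 m2 :: int.
      of_int l1 * x1 + of_int l2 * x2 + of_int m1 * (r + y) + of_int m2 * (r - w / y) = 0
      \<Longrightarrow> m1 = 0 \<and> m2 = 0"
proof -
  define p :: "int \<times> int \<times> int \<times> int \<Rightarrow> real poly" where "p = (\<lambda>(l1, l2, m1, m2).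
    [: - of_int m2 * w, of_int l1 * x1 + of_int l2 * x2 + of_int (m1 + m2) * r, of_int m1 :])"
  define bad where "bad = (\<Union>q \<in> {q. p q \<noteq> 0}. {y. poly (p q) y = 0})"
  have "countable bad"
    unfolding bad_def by (intro countable_UN) (auto intro: countable_finite poly_roots_finite)
  moreover have "uncountable {0<..<1::real}" by (simp add: uncountable_open_interval)
  ultimately obtain y where y: "y \<in> {0<..<1}" "y \<notin> bad"
    by (metis countable_subset subsetI)
  show ?thesis
  proof (rule that)
    show "0 < y" using y by simp
    fix l1 l2 m1 m2 :: int
    assume rel: "of_int l1 * x1 + of_int l2 * x2 + of_int m1 * (r + y) + of_int m2 * (r - w / y) = 0"
    have "poly (p (l1, l2, m1, m2)) y = 0"
    proof -
      have "poly (p (l1, l2, m1, m2)) y = y *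
          (of_int l1 * x1 + of_int l2 * x2 + of_int m1 * (r + y) + of_int m2 * (r - w / y))"
        using \<open>0 < y\<close> by (simp add: p_def field_simps)
      then show ?thesis by (simp only: rel mult_zero_right)
    qed
    with y(2) have "p (l1, l2, m1, m2) = 0" by (auto simp: bad_def)
    with assms show "m1 = 0 \<and> m2 = 0" by (simp add: p_def)
  qed
qed

lemma norm_cis_diff_le: "cmod (cis x - cis y) \<le> \<bar>x - y - 2 * pi * of_int h\<bar>"
proof -
  define z where "z = x - y - 2 * pi * of_int h"
  have "cis x = cis (y + z + 2 * pi * of_int h)" by (simp add: z_def)
  also have "\<dots> = cis y * cis z" by (simp add: cis_multiple_2pi flip: cis_mult)
  finally have "cis x - cis y = cis y * (exp (\<i> * of_real z) - 1)"
    by (simp add: right_diff_distrib cis_conv_exp)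
  then have "cmod (cis x - cis y) = 2 * \<bar>sin (z / 2)\<bar>"
    by (simp add: norm_mult dist_exp_i_1)
  also have "\<dots> \<le> \<bar>z\<bar>" using abs_sin_x_le_abs_x[of "z / 2"] by simp
  finally show ?thesis by (simp add: z_def)
qed

text \<open>
  A common phase is irrelevant, so all eigenvalues are compared with \<open>k\<close>: the differences of
  \<open>\<theta>\<close> and \<open>\<tau>\<close> from \<open>k\<close> should perform almost full turns, those of the two movable
  eigenvalues almost half turns.
\<close>

lemma exists_parameter_aligning_phases:
  fixes k \<theta> \<tau> r w :: real
  assumes ne: "\<theta> \<noteq> k" "\<tau> \<noteq> k" and "0 < w"
  obtains y where "0 < y"
    "\<And>\<epsilon>. 0 < \<epsilon> \<Longrightarrow> \<exists>t>0. \<exists>\<omega>. cmod \<omega> = 1 \<and>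
       (\<forall>l\<in>{k, \<theta>, \<tau>}. cmod (cis (t * l) - \<omega>) \<le> \<epsilon>) \<and>
       (\<forall>l\<in>{r + y, r - w / y}. cmod (cis (t * l) + \<omega>) \<le> \<epsilon>)"
proof -
  obtain y where "0 < y" and indep: "\<And>l1 l2 m1 m2 :: int.
      of_int l1 * (\<theta> - k) + of_int l2 * (\<tau> - k) + of_int m1 * (r - k + y)
        + of_int m2 * (r - k - w / y) = 0
      \<Longrightarrow> m1 = 0 \<and> m2 = 0"
    using exists_generic_parameter[OF \<open>0 < w\<close>] by metis
  show ?thesis
  proof (rule that[OF \<open>0 < y\<close>])
    fix \<epsilon> :: real assume "0 < \<epsilon>"
    \<comment> \<open>An accuracy below \<open>1\<close> excludes the time \<open>0\<close>, at which all phases coincide.\<close>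
    define \<eta> where "\<eta> = min \<epsilon> (1/2)"
    define good where "good t \<omega> \<longleftrightarrow> cmod \<omega> = 1 \<and> (\<forall>l\<in>{k, \<theta>, \<tau>}. cmod (cis (t * l) - \<omega>) \<le> \<eta>) \<and>
       (\<forall>l\<in>{r + y, r - w / y}. cmod (cis (t * l) + \<omega>) \<le> \<eta>)" for t \<omega>
    have "0 < \<eta> / (2 * pi)" using \<open>0 < \<epsilon>\<close> by (simp add: \<eta>_def)
    moreover have "\<theta> - k \<noteq> 0" "\<tau> - k \<noteq> 0" using ne by auto
    ultimately have "\<exists>t h1 h2 k1 k2. \<bar>t * (\<theta> - k) - of_int h1\<bar> < \<eta> / (2 * pi) \<and>
      \<bar>t * (\<tau> - k) - of_int h2\<bar> < \<eta> / (2 * pi) \<and>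
      \<bar>t * (r - k + y) - of_int k1 - 1/2\<bar> < \<eta> / (2 * pi) \<and>
      \<bar>t * (r - k - w / y) - of_int k2 - 1/2\<bar> < \<eta> / (2 * pi)"
      by (elim simultaneous_half_turn[where ?y1.0 = "r - k + y" and ?y2.0 = "r - k - w / y", rotated 3])
        (use indep in blast)+
    then obtain t h1 h2 k1 k2 where t:
      "\<bar>t * (\<theta> - k) - of_int h1\<bar> < \<eta> / (2 * pi)" "\<bar>t * (\<tau> - k) - of_int h2\<bar> < \<eta> / (2 * pi)"
      "\<bar>t * (r - k + y) - of_int k1 - 1/2\<bar> < \<eta> / (2 * pi)"
      "\<bar>t * (r - k - w / y) - of_int k2 - 1/2\<bar> < \<eta> / (2 * pi)"
      by blast
    define s where "s = 2 * pi * t"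
    have close: "cmod (cis (s * l) - cis (s * k + 2 * pi * b)) \<le> \<eta>"
      if "\<bar>t * (l - k) - of_int h - b\<bar> < \<eta> / (2 * pi)" for l b :: real and h
    proof -
      have "cmod (cis (s * l) - cis (s * k + 2 * pi * b))
          \<le> \<bar>s * l - (s * k + 2 * pi * b) - 2 * pi * of_int h\<bar>"
        by (rule norm_cis_diff_le)
      also have "\<dots> = \<bar>2 * pi * (t * (l - k) - of_int h - b)\<bar>" by (simp add: s_def algebra_simps)
      also have "\<dots> = 2 * pi * \<bar>t * (l - k) - of_int h - b\<bar>" by (simp add: abs_mult)
      also have "\<dots> \<le> \<eta>" using that by (simp add: field_simps)
      finally show ?thesis .
    qed
    have half: "cis (s * k + 2 * pi * (1/2)) = - cis (s * k)" by (simp flip: cis_mult)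
    have "0 \<le> \<eta>" using \<open>0 < \<epsilon>\<close> by (simp add: \<eta>_def)
    then have good: "good s (cis (s * k))"
      using close[of \<theta> h1 0] close[of \<tau> h2 0] close[of "r + y" k1 "1/2"]
        close[of "r - w / y" k2 "1/2"] t
      unfolding good_def half by (simp add: algebra_simps)
    have "s \<noteq> 0"
      using good by (auto simp: good_def \<eta>_def)
    have "\<exists>t>0. \<exists>\<omega>. good t \<omega>"
    proof (cases "s > 0")
      case False
      \<comment> \<open>Reversing time conjugates all phases and keeps the distances between them.\<close>
      have "good (- s) (cnj (cis (s * k)))"
        using good unfolding good_def
        by (simp flip: cis_cnj complex_cnj_diff complex_cnj_add)
      with False \<open>s \<noteq> 0\<close> show ?thesis by (intro exI[of _ "- s"]) auto
    qed (use good in blast)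
    then show "\<exists>t>0. \<exists>\<omega>. cmod \<omega> = 1 \<and> (\<forall>l\<in>{k, \<theta>, \<tau>}. cmod (cis (t * l) - \<omega>) \<le> \<epsilon>) \<and>
       (\<forall>l\<in>{r + y, r - w / y}. cmod (cis (t * l) + \<omega>) \<le> \<epsilon>)"
      unfolding good_def \<eta>_def by auto
  qed
qed

section \<open>An antisymmetric rank-one perturbation\<close>

lemma outer_prod_mult_vector: "outer_prod x y *v z = (y \<bullet> z) *\<^sub>R x"
  by (simp add: outer_prod_def matrix_vector_mult_def inner_vec_def vec_eq_iff sum_distrib_left mult_ac)

text \<open>
  For \<open>\<beta> = - \<gamma>\<close> the perturbation has rank one and sees only the difference of the values at \<open>u\<close>
  and \<open>v\<close>.
\<close>

lemma perturbation_antisymmetric: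
  fixes x :: "real^'v"
  shows "perturbation u v (- (q / 2)) (q / 2) *v x
    = (q / 2 * (x $ u - x $ v)) *\<^sub>R (axis u 1 - axis v 1)"
  by (simp add: perturbation_def matrix_vector_mult_add_rdistrib outer_prod_mult_vector
      inner_axis' algebra_simps flip: scaleR_matrix_vector_assoc)

lemma eigenspace_perturbation_symmetric:
  fixes A :: "real^'v^'v"
  assumes "x \<in> eigenspace A l" "x $ u = x $ v"
  shows "x \<in> eigenspace (A + perturbation u v (- (q / 2)) (q / 2)) l"
  using assms
  by (simp add: eigenspace_def matrix_vector_mult_add_rdistrib perturbation_antisymmetric)

text \<open>
  The quadratic relation for \<open>A\<close> makes the span of \<open>d\<close> and \<open>A d\<close> invariant under the perturbed
  matrix \<open>M\<close>.  Comparing the coefficients of \<open>A d\<close> in \<open>M (A d + x d)\<close> forces the eigenvalue to be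
  \<open>b + x\<close>; those of \<open>d\<close> then give the quadratic equation for \<open>x\<close>.
\<close>

lemma eigenspace_perturbation_antisymmetric:
  fixes A :: "real^'v^'v" and u v :: 'v and \<alpha> b \<delta> q x :: real
  defines "d \<equiv> axis u 1 - axis v 1"
  assumes "u \<noteq> v"
    and square: "A *v (A *v d) = \<alpha> *\<^sub>R d + b *\<^sub>R (A *v d)"
    and \<delta>: "(A *v d) $ u - (A *v d) $ v = 2 * \<delta>"
    and root: "x * (b + x) = \<alpha> + q * \<delta> + q * x"
  shows "A *v d + x *\<^sub>R d \<in> eigenspace (A + perturbation u v (- (q / 2)) (q / 2)) (b + x)"
proof -
  let ?f = "A *v d + x *\<^sub>R d"
  have "d $ u - d $ v = 2" using \<open>u \<noteq> v\<close> by (simp add: d_def axis_def)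
  then have "?f $ u - ?f $ v = 2 * \<delta> + 2 * x"
    using \<delta> by (simp add: algebra_simps)
  then have "(A + perturbation u v (- (q / 2)) (q / 2)) *v ?f
      = A *v ?f + (q / 2 * (2 * \<delta> + 2 * x)) *\<^sub>R d"
    by (simp only: matrix_vector_mult_add_rdistrib perturbation_antisymmetric d_def)
  also have "A *v ?f = \<alpha> *\<^sub>R d + b *\<^sub>R (A *v d) + x *\<^sub>R (A *v d)"
    by (simp add: matrix_vector_right_distrib matrix_vector_mult_scaleR square)
  also have "\<dots> + (q / 2 * (2 * \<delta> + 2 * x)) *\<^sub>R d
      = (b + x) *\<^sub>R (A *v d) + (\<alpha> + q * \<delta> + q * x) *\<^sub>R d"
    by (simp add: algebra_simps)
  also have "\<dots> = (b + x) *\<^sub>R ?f"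
    unfolding root[symmetric] by (simp add: scaleR_add_right mult.commute)
  finally show ?thesis by (simp add: eigenspace_def)
qed

text \<open>
  Half of the right-hand side is the parameter \<open>w\<close> in the eigenvalue \<open>r - w/y\<close>.  As a squared norm
  it is nonnegative, and it vanishes exactly if \<open>d\<close> is already an eigenvector of \<open>A\<close>.
\<close>

lemma norm_antisymmetric_vector:
  fixes A :: "real^'v^'v" and u v :: 'v and \<alpha> b \<delta> :: real
  defines "d \<equiv> axis u 1 - axis v 1"
  assumes "u \<noteq> v"
    and sym: "\<And>x y. x \<bullet> (A *v y) = (A *v x) \<bullet> y"
    and square: "A *v (A *v d) = \<alpha> *\<^sub>R d + b *\<^sub>R (A *v d)"
    and \<delta>: "(A *v d) $ u - (A *v d) $ v = 2 * \<delta>"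
  shows "(norm (A *v d - \<delta> *\<^sub>R d))\<^sup>2 = 2 * (\<alpha> + b * \<delta> - \<delta>\<^sup>2)"
proof -
  have "d \<bullet> x = x $ u - x $ v" for x by (simp add: d_def inner_diff_left inner_axis')
  then have dAd: "d \<bullet> (A *v d) = 2 * \<delta>" and dd: "d \<bullet> d = 2"
    using \<open>u \<noteq> v\<close> \<delta> by (simp_all add: d_def axis_def)
  have "(A *v d) \<bullet> (A *v d) = d \<bullet> (A *v (A *v d))" using sym by metis
  also have "\<dots> = 2 * \<alpha> + 2 * b * \<delta>" by (simp add: square inner_add_right dd dAd)
  finally have Ad: "(A *v d) \<bullet> (A *v d) = 2 * \<alpha> + 2 * b * \<delta>" .
  have "(norm (A *v d - \<delta> *\<^sub>R d))\<^sup>2 = (A *v d - \<delta> *\<^sub>R d) \<bullet> (A *v d - \<delta> *\<^sub>R d)"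
    by (rule power2_norm_eq_inner)
  also have "\<dots> = (A *v d) \<bullet> (A *v d) - 2 * \<delta> * (d \<bullet> (A *v d)) + \<delta>\<^sup>2 * (d \<bullet> d)"
    by (simp add: inner_diff_left inner_diff_right inner_commute[of "A *v d" d]
        power2_eq_square algebra_simps)
  also have "\<dots> = 2 * (\<alpha> + b * \<delta> - \<delta>\<^sup>2)"
    unfolding Ad dd dAd by (simp add: power2_eq_square algebra_simps)
  finally show ?thesis .
qed

text \<open>
  For the value of \<open>q\<close> below, the quadratic equation of \<open>eigenspace_perturbation_antisymmetric\<close> has the roots
  \<open>y - \<delta>\<close> and \<open>- \<delta> - w/y\<close>, and \<open>d\<close> is a multiple of the difference of the corresponding
  eigenvectors.  If \<open>w = 0\<close>, the vector belonging to the second root is zero.  Its eigenvalue must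
  then be left out, because it would be \<open>b - \<delta>\<close> whatever \<open>y\<close> is, and its phase could not be
  adjusted.
\<close>

lemma antisymmetric_vector_in_span:
  fixes A :: "real^'v^'v" and u v :: 'v and \<alpha> b \<delta> y :: real
  defines "d \<equiv> axis u 1 - axis v 1"
    and "w \<equiv> \<alpha> + b * \<delta> - \<delta>\<^sup>2"
  defines "q \<equiv> b - 2 * \<delta> + y - w / y"
  assumes "u \<noteq> v"
    and sym: "\<And>x y. x \<bullet> (A *v y) = (A *v x) \<bullet> y"
    and square: "A *v (A *v d) = \<alpha> *\<^sub>R d + b *\<^sub>R (A *v d)"
    and \<delta>: "(A *v d) $ u - (A *v d) $ v = 2 * \<delta>"
    and "0 < y"
  shows "d \<in> span (\<Union>l \<in> {b - \<delta> + y} \<union> (if w = 0 then {} else {b - \<delta> - w / y}).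
      eigenspace (A + perturbation u v (- (q / 2)) (q / 2)) l)"
    (is "d \<in> span (\<Union>l \<in> ?T. eigenspace ?M l)")
proof -
  define f where "f x = A *v d + x *\<^sub>R d" for x
  have norm_f: "(norm (f (- \<delta>)))\<^sup>2 = 2 * w"
    using norm_antisymmetric_vector[of u v A \<alpha> b \<delta>] assms(4) sym square \<delta>
    by (simp add: f_def d_def w_def)
  then have "0 \<le> w" by (metis zero_le_mult_iff zero_le_power2 zero_less_numeral not_le)
  then have pos: "0 < y + w / y" using \<open>0 < y\<close> by (simp add: add_pos_nonneg)
  have eig: "f x \<in> eigenspace ?M (b + x)" if "x * (b + x) = \<alpha> + q * \<delta> + q * x" for x
    unfolding f_def using eigenspace_perturbation_antisymmetric[of u v A \<alpha> b \<delta> x q]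
      assms(4) square \<delta> that by (simp add: d_def)
  have f1: "f (y - \<delta>) \<in> span (\<Union>l \<in> ?T. eigenspace ?M l)"
  proof -
    have "(y - \<delta>) * (b + (y - \<delta>)) = \<alpha> + q * \<delta> + q * (y - \<delta>)"
      using \<open>0 < y\<close> by (simp add: q_def w_def field_simps power2_eq_square)
    from eig[OF this] show ?thesis by (intro span_base) (auto simp: algebra_simps)
  qed
  have f2: "f (- \<delta> - w / y) \<in> span (\<Union>l \<in> ?T. eigenspace ?M l)"
  proof (cases "w = 0")
    case True
    then show ?thesis using norm_f by (simp add: span_zero)
  next
    case False
    have "(- \<delta> - w / y) * (b + (- \<delta> - w / y)) = \<alpha> + q * \<delta> + q * (- \<delta> - w / y)"
      using \<open>0 < y\<close> by (simp add: q_def w_def field_simps power2_eq_square)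
    from eig[OF this] False show ?thesis by (intro span_base) (auto simp: algebra_simps)
  qed
  have "f (y - \<delta>) - f (- \<delta> - w / y) = (y + w / y) *\<^sub>R d"
    by (simp add: f_def algebra_simps)
  then have "d = (1 / (y + w / y)) *\<^sub>R (f (y - \<delta>) - f (- \<delta> - w / y))"
    using pos by simp
  then show ?thesis
    using span_scale[OF span_diff[OF f1 f2]] by metis
qed

section \<open>Strongly regular graphs\<close>

lemma strongly_regular_symmetric:
  assumes "strongly_regular E n k a c"
  shows "E x y \<longleftrightarrow> E y x" "\<not> E x x"
  using assms by (auto simp: strongly_regular_def simple_graph_def symp_def irreflp_def)

lemma adj_matrix_inner_symmetric:
  assumes "strongly_regular E n k a c"
  shows "x \<bullet> (adj_matrix E *v y) = (adj_matrix E *v x) \<bullet> y"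
proof -
  have "transpose (adj_matrix E) = adj_matrix E"
    using strongly_regular_symmetric[OF assms] by (auto simp: transpose_def adj_matrix_def vec_eq_iff)
  then show ?thesis by (metis dot_lmul_matrix vector_transpose_matrix)
qed

lemma adj_matrix_mult_one:
  assumes "strongly_regular E n k a c"
  shows "adj_matrix E *v 1 = real k *\<^sub>R 1"
  using assms
  by (simp add: strongly_regular_def vec_eq_iff matrix_vector_mult_def adj_matrix_def
      flip: of_bool_def)

text \<open>
  The entries of \<open>A\<^sup>2\<close> count common neighbours, hence \<open>A\<^sup>2 = (k - c) I + (a - c) A + c J\<close> with the
  all-ones matrix \<open>J\<close>.
\<close>

lemma adj_matrix_square:
  fixes E :: "'v::finite \<Rightarrow> 'v \<Rightarrow> bool"
  assumes srg: "strongly_regular E n k a c"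
  shows "adj_matrix E *v (adj_matrix E *v x) =
    (real k - real c) *\<^sub>R x + (real a - real c) *\<^sub>R (adj_matrix E *v x) + (real c * (1 \<bullet> x)) *\<^sub>R 1"
proof -
  let ?A = "adj_matrix E"
  note sym = strongly_regular_symmetric[OF srg]
  have entry: "(?A ** ?A) $ i $ j = (real k - real c) * of_bool (i = j)
      + (real a - real c) * ?A $ i $ j + real c"
    for i j
  proof -
    have "(?A ** ?A) $ i $ j = (\<Sum>l\<in>UNIV. of_bool (E i l \<and> E j l))"
      unfolding matrix_matrix_mult_def adj_matrix_def using sym(1)
      by (simp add: of_bool_def) (intro sum.cong, auto)
    also have "\<dots> = real (card {l. E i l \<and> E j l})" by simp
    also have "card {l. E i l \<and> E j l} = (if i = j then k else if E i j then a else c)"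
      using srg by (auto simp: strongly_regular_def)
    finally show ?thesis using sym(2) by (auto simp: adj_matrix_def)
  qed
  show ?thesis
  proof (simp add: vec_eq_iff matrix_vector_mul_assoc, intro allI)
    fix i
    have "((?A ** ?A) *v x) $ i = (\<Sum>j\<in>UNIV. (real k - real c) * (of_bool (i = j) * x $ j)
        + (real a - real c) * (?A $ i $ j * x $ j) + real c * x $ j)"
      unfolding matrix_vector_mult_def by (simp add: entry algebra_simps)
    also have "\<dots> = (real k - real c) * x $ i
        + (real a - real c) * (?A *v x) $ i + real c * (1 \<bullet> x)"
      by (simp add: sum.distrib matrix_vector_mult_def inner_vec_def flip: sum_distrib_left)
    finally show "((?A ** ?A) *v x) $ i = (real k - real c) * x $ i
        + (real a - real c) * (?A *v x) $ i + real c * (1 \<bullet> x)" .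
  qed
qed

text \<open>
  Eigenvectors of eigenvalues other than \<open>k\<close> are orthogonal to the all-ones vector, on whose
  orthogonal complement the term with \<open>J\<close> disappears.
\<close>

lemma restricted_eigenvalue_root:
  assumes srg: "strongly_regular E n k a c"
    and "l \<in> eigenvalues (adj_matrix E)" "l \<noteq> real k"
  shows "l\<^sup>2 = (real k - real c) + (real a - real c) * l"
proof -
  obtain x where Ax: "adj_matrix E *v x = l *\<^sub>R x" and "x \<noteq> 0"
    using assms(2) by (auto simp: eigenvalues_def eigenspace_def)
  have "l * (1 \<bullet> x) = real k * (1 \<bullet> x)"
    using adj_matrix_inner_symmetric[OF srg, of 1 x] by (simp add: Ax adj_matrix_mult_one[OF srg])
  with \<open>l \<noteq> real k\<close> have "1 \<bullet> x = 0" by auto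
  with adj_matrix_square[OF srg, of x]
  have "(l\<^sup>2) *\<^sub>R x = ((real k - real c) + (real a - real c) * l) *\<^sub>R x"
    by (simp add: Ax matrix_vector_mult_scaleR power2_eq_square scaleR_add_left)
  with \<open>x \<noteq> 0\<close> show ?thesis by (metis scaleR_cancel_right)
qed

lemma adj_matrix_mult_axis: "(adj_matrix E *v axis u 1) $ i = of_bool (E i u)"
  by (simp add: matrix_vector_mult_basis column_def adj_matrix_def)

text \<open>
  Remove from \<open>s\<close> its component \<open>(2/n) 1\<close> along the all-ones vector.  The rest \<open>g\<close> is annihilated
  by \<open>(A - \<theta>) (A - \<tau>)\<close>, so \<open>(A - \<tau>) g\<close> and \<open>(A - \<theta>) g\<close> lie in eigenspaces of \<open>A\<close>.  They
  take equal values at \<open>u\<close> and \<open>v\<close>, so the perturbation leaves them there.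
\<close>

lemma symmetric_vector_in_span:
  fixes E :: "'v::finite \<Rightarrow> 'v \<Rightarrow> bool"
  assumes srg: "strongly_regular E n k a c"
    and "u \<noteq> v" "\<theta> \<noteq> \<tau>"
    and sum: "\<theta> + \<tau> = real a - real c" and prod: "\<theta> * \<tau> = real c - real k"
  shows "axis u 1 + axis v 1 \<in> span (\<Union>l\<in>{real k, \<theta>, \<tau>}.
    eigenspace (adj_matrix E + perturbation u v (- (q / 2)) (q / 2)) l)"
    (is "?s \<in> span (\<Union>l\<in>?S. eigenspace ?M l)")
proof -
  let ?A = "adj_matrix E"
  note sym = strongly_regular_symmetric[OF srg]
  define g where "g = ?s - (2 / real CARD('v)) *\<^sub>R 1"
  have "1 \<bullet> (1 :: real^'v) = real CARD('v)" by (simp add: inner_vec_def)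
  then have "1 \<bullet> g = 0" by (simp add: g_def inner_diff_right inner_add_right inner_axis)
  then have Ag: "?A *v (?A *v g) = (- (\<theta> * \<tau>)) *\<^sub>R g + (\<theta> + \<tau>) *\<^sub>R (?A *v g)"
    by (simp add: adj_matrix_square[OF srg] sum prod)
  have g_uv: "g $ u = g $ v" "(?A *v g) $ u = (?A *v g) $ v"
    using \<open>u \<noteq> v\<close> sym
    by (simp_all add: g_def axis_def[of _ 1] matrix_vector_mult_diff_distrib matrix_vector_right_distrib
        matrix_vector_mult_scaleR adj_matrix_mult_one[OF srg])
      (simp add: adj_matrix_mult_axis flip: axis_def)
  have factor: "?A *v g - m *\<^sub>R g \<in> span (\<Union>l\<in>?S. eigenspace ?M l)"
    if "l \<in> ?S" "l + m = \<theta> + \<tau>" "l * m = \<theta> * \<tau>" for l m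
  proof -
    have "?A *v g - m *\<^sub>R g \<in> eigenspace ?A l"
      using that(2,3)
      by (simp add: eigenspace_def matrix_vector_mult_diff_distrib matrix_vector_mult_scaleR Ag
          scaleR_diff_right flip: that(2,3)) (simp add: algebra_simps)
    then show ?thesis
      using that(1) g_uv by (intro span_base UN_I[of l] eigenspace_perturbation_symmetric) auto
  qed
  have one: "1 \<in> span (\<Union>l\<in>?S. eigenspace ?M l)"
    by (intro span_base UN_I[of "real k"] eigenspace_perturbation_symmetric)
      (auto simp: eigenspace_def adj_matrix_mult_one[OF srg])
  have "(?A *v g - \<tau> *\<^sub>R g) - (?A *v g - \<theta> *\<^sub>R g) = (\<theta> - \<tau>) *\<^sub>R g"
    by (simp add: algebra_simps)
  then have "?s = (1 / (\<theta> - \<tau>)) *\<^sub>R ((?A *v g - \<tau> *\<^sub>R g) - (?A *v g - \<theta> *\<^sub>R g))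
      + (2 / real CARD('v)) *\<^sub>R 1"
    using \<open>\<theta> \<noteq> \<tau>\<close> by (simp add: g_def)
  moreover have "\<dots> \<in> span (\<Union>l\<in>?S. eigenspace ?M l)"
    by (intro span_add span_scale span_diff factor one) auto
  ultimately show ?thesis by metis
qed
theorem theorem2:
  fixes E :: "'v::finite \<Rightarrow> 'v \<Rightarrow> bool" and n k a c :: nat and \<theta> \<tau> :: real
  assumes "strongly_regular E n k a c"
    and "distinct [real k, \<theta>, \<tau>]"
    and "eigenvalues (adj_matrix E) = {real k, \<theta>, \<tau>}"
    and "simple_eigenvalue (adj_matrix E) (real k)"
  shows "\<forall>u v. u \<noteq> v \<longrightarrow>
    (\<exists>\<beta> \<gamma> :: real. pretty_good_state_transfer (adj_matrix E + perturbation u v \<beta> \<gamma>) u v)"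
proof (intro allI impI)
  fix u v :: 'v assume "u \<noteq> v"
  note srg = assms(1)
  let ?A = "adj_matrix E"
  let ?d = "axis u 1 - axis v 1 :: real^'v"
  define \<alpha> b \<delta> :: real where "\<alpha> = real k - real c" and "b = real a - real c"
    and "\<delta> = - of_bool (E u v)"
  have ne: "\<theta> \<noteq> real k" "\<tau> \<noteq> real k" "\<theta> \<noteq> \<tau>" using assms(2) by auto
  have roots: "\<theta>\<^sup>2 = \<alpha> + b * \<theta>" "\<tau>\<^sup>2 = \<alpha> + b * \<tau>"
    using restricted_eigenvalue_root[OF srg] assms(3) ne by (auto simp: \<alpha>_def b_def)
  then have "(\<theta> - \<tau>) * (\<theta> + \<tau> - b) = 0" by (simp add: algebra_simps power2_eq_square)
  then have sum: "\<theta> + \<tau> = b" using ne by simp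
  have "\<theta> * \<tau> = \<theta> * (\<theta> + \<tau>) - \<theta>\<^sup>2" by (simp add: algebra_simps power2_eq_square)
  also have "\<dots> = - \<alpha>" unfolding roots(1) sum by simp
  finally have prod: "\<theta> * \<tau> = - \<alpha>" .
  have "1 \<bullet> ?d = 0" by (simp add: inner_diff_right inner_axis)
  then have square: "?A *v (?A *v ?d) = \<alpha> *\<^sub>R ?d + b *\<^sub>R (?A *v ?d)"
    by (simp add: adj_matrix_square[OF srg] \<alpha>_def b_def)
  have \<delta>: "(?A *v ?d) $ u - (?A *v ?d) $ v = 2 * \<delta>"
    using strongly_regular_symmetric[OF srg]
    by (simp add: matrix_vector_mult_diff_distrib adj_matrix_mult_axis \<delta>_def)
  note inner_sym = adj_matrix_inner_symmetric[OF srg]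
  define w where "w = \<alpha> + b * \<delta> - \<delta>\<^sup>2"
  have "0 \<le> 2 * w"
    unfolding w_def norm_antisymmetric_vector[OF \<open>u \<noteq> v\<close> inner_sym square \<delta>, symmetric] by simp
  \<comment> \<open>If \<open>w = 0\<close>, only the eigenvalue \<open>b - \<delta> + y\<close> occurs in \<open>d\<close>; any positive number then serves
    in the choice of \<open>y\<close>.\<close>
  define w' where "w' = (if w = 0 then 1 else w)"
  have "0 < w'" using \<open>0 \<le> 2 * w\<close> by (simp add: w'_def)
  then obtain y where "0 < y" and phases: "\<And>\<epsilon>. 0 < \<epsilon> \<Longrightarrow> \<exists>t>0. \<exists>\<omega>. cmod \<omega> = 1 \<and>
       (\<forall>l\<in>{real k, \<theta>, \<tau>}. cmod (cis (t * l) - \<omega>) \<le> \<epsilon>) \<and>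
       (\<forall>l\<in>{b - \<delta> + y, b - \<delta> - w' / y}. cmod (cis (t * l) + \<omega>) \<le> \<epsilon>)"
    using exists_parameter_aligning_phases[OF ne(1,2), of w' "b - \<delta>"] by blast
  define q where "q = b - 2 * \<delta> + y - w / y"
  let ?M = "?A + perturbation u v (- (q / 2)) (q / 2)"
  have "pretty_good_state_transfer ?M u v"
  proof (rule pretty_good_state_transfer_criterion)
    show "axis u 1 + axis v 1 \<in> span (\<Union>l\<in>{real k, \<theta>, \<tau>}. eigenspace ?M l)"
      using sum prod by (intro symmetric_vector_in_span[OF srg \<open>u \<noteq> v\<close> ne(3)]) (auto simp: \<alpha>_def b_def)
    show "?d \<in> span (\<Union>l\<in>{b - \<delta> + y} \<union> (if w = 0 then {} else {b - \<delta> - w / y}). eigenspace ?M l)"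
      unfolding q_def w_def
      by (rule antisymmetric_vector_in_span[OF \<open>u \<noteq> v\<close> inner_sym square \<delta> \<open>0 < y\<close>])
    have "{b - \<delta> + y} \<union> (if w = 0 then {} else {b - \<delta> - w / y}) \<subseteq> {b - \<delta> + y, b - \<delta> - w' / y}"
      by (simp add: w'_def)
    then show "\<exists>t>0. \<exists>\<omega>. cmod \<omega> = 1 \<and> (\<forall>l\<in>{real k, \<theta>, \<tau>}. cmod (cis (t * l) - \<omega>) \<le> \<epsilon>) \<and>
        (\<forall>l\<in>{b - \<delta> + y} \<union> (if w = 0 then {} else {b - \<delta> - w / y}). cmod (cis (t * l) + \<omega>) \<le> \<epsilon>)"
      if "0 < \<epsilon>" for \<epsilon>
      using phases[OF that] by (meson subsetD)
  qed
  then show "\<exists>\<beta> \<gamma> :: real. pretty_good_state_transfer (?A + perturbation u v \<beta> \<gamma>) u v" by blast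
qed

end
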